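(* Let $V$ be a finite-dimensional vector space over $\mathbb{R}$ and let $G$ be a locally compact subgroup of $GL(V)$. Suppose $G$ has a unipotent subgroup $U$ such that $U$ has only one linearly independent invariant vector in $V$, i.e. the subspace $\{v\in V \mid uv = v \text{ for all } u\in U\}$ is one-dimensional. Then $G$ has Liouville property on $\mathbb{P}(V)$ (for the projective linear action).
   Context: A subgroup of $GL(V)$ is unipotent if all its elements are unipotent linear transformations. Probability measures on a locally compact group $G$ are regular Borel probability measures. For such a measure $\mu$, $G_\mu$ (resp. $S_\mu$) denotes the closed subgroup (resp. closed subsemigroup) of $G$ generated by the support of $\mu$; $\mu$ is called irreducible if $S_\mu = G$. A $G$-space $E$ is a locally compact space with a continuous $G$-action. A bounded measurable function $f$ on $E$ is called $\mu$-harmonic if $\int f(gx)\,d\mu(g) = f(x)$ for all $x\in E$. The measure $\mu$ has Liouville property on $E$ if every continuous bounded $\mu$-harmonic function on $E$ is $G_\mu$-invariant. The group $G$ has Liouville property on $E$ if every irreducible probability measure on $G$ has Liouville property on $E$. For a vector space $V$, $\mathbb{P}(V)$ denotes the corresponding projective space (the space of one-dimensional subspaces of $V$). *)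

theory Defs
  imports "HOL-Analysis.Analysis" "HOL-Algebra.Group"
begin

text \<open>A topological group is given by a group \<open>G\<close> together with a topology \<open>T\<close> on its carrier;
  a \<open>G\<close>-space by a topology \<open>E\<close> and an action \<open>act\<close> on its points. The notions below are meant for
  a locally compact group \<open>(G, T)\<close> and a \<open>G\<close>-space \<open>(E, act)\<close>, but do not include these
  requirements.\<close>

definition borel_of :: "'a topology \<Rightarrow> 'a measure" where
  "borel_of X = sigma (topspace X) {U. openin X U}"

definition regular_prob_measure :: "'a topology \<Rightarrow> 'a measure \<Rightarrow> bool" where
  "regular_prob_measure T \<mu> \<longleftrightarrow>
     sets \<mu> = sets (borel_of T) \<and> emeasure \<mu> (space \<mu>) = 1 \<and>
     (\<forall>A \<in> sets \<mu>. emeasure \<mu> A = (INF U \<in> {U. openin T U \<and> A \<subseteq> U}. emeasure \<mu> U)) \<and>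
     (\<forall>A \<in> sets \<mu>. emeasure \<mu> A = (SUP K \<in> {K \<in> sets \<mu>. compactin T K \<and> K \<subseteq> A}. emeasure \<mu> K))"

definition measure_support :: "'a topology \<Rightarrow> 'a measure \<Rightarrow> 'a set" where
  "measure_support T \<mu> = {x \<in> topspace T. \<forall>U. openin T U \<and> x \<in> U \<longrightarrow> emeasure \<mu> U > 0}"

definition subsemigroup :: "'g set \<Rightarrow> ('g, 'b) monoid_scheme \<Rightarrow> bool" where
  "subsemigroup S G \<longleftrightarrow> S \<subseteq> carrier G \<and> (\<forall>x \<in> S. \<forall>y \<in> S. x \<otimes>\<^bsub>G\<^esub> y \<in> S)"

definition closed_subgroup_of_measure ::
    "('g, 'b) monoid_scheme \<Rightarrow> 'g topology \<Rightarrow> 'g measure \<Rightarrow> 'g set" where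
  "closed_subgroup_of_measure G T \<mu> =
     \<Inter> {H. subgroup H G \<and> closedin T H \<and> measure_support T \<mu> \<subseteq> H}"

definition closed_subsemigroup_of_measure ::
    "('g, 'b) monoid_scheme \<Rightarrow> 'g topology \<Rightarrow> 'g measure \<Rightarrow> 'g set" where
  "closed_subsemigroup_of_measure G T \<mu> =
     \<Inter> {S. subsemigroup S G \<and> closedin T S \<and> measure_support T \<mu> \<subseteq> S}"

definition irreducible_measure ::
    "('g, 'b) monoid_scheme \<Rightarrow> 'g topology \<Rightarrow> 'g measure \<Rightarrow> bool" where
  "irreducible_measure G T \<mu> \<longleftrightarrow> closed_subsemigroup_of_measure G T \<mu> = carrier G"

definition harmonic_on ::
    "'g measure \<Rightarrow> 'e topology \<Rightarrow> ('g \<Rightarrow> 'e \<Rightarrow> 'e) \<Rightarrow> ('e \<Rightarrow> real) \<Rightarrow> bool" where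
  "harmonic_on \<mu> E act f \<longleftrightarrow>
     f \<in> borel_measurable (borel_of E) \<and> bounded (f ` topspace E) \<and>
     (\<forall>x \<in> topspace E. (\<integral>g. f (act g x) \<partial>\<mu>) = f x)"

definition measure_has_Liouville_property ::
    "('g, 'b) monoid_scheme \<Rightarrow> 'g topology \<Rightarrow> 'g measure \<Rightarrow> 'e topology \<Rightarrow> ('g \<Rightarrow> 'e \<Rightarrow> 'e) \<Rightarrow> bool"
  where
  "measure_has_Liouville_property G T \<mu> E act \<longleftrightarrow>
     (\<forall>f. continuous_map E euclideanreal f \<and> harmonic_on \<mu> E act f \<longrightarrow>
       (\<forall>g \<in> closed_subgroup_of_measure G T \<mu>. \<forall>x \<in> topspace E. f (act g x) = f x))"

definition group_has_Liouville_property ::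
    "('g, 'b) monoid_scheme \<Rightarrow> 'g topology \<Rightarrow> 'e topology \<Rightarrow> ('g \<Rightarrow> 'e \<Rightarrow> 'e) \<Rightarrow> bool" where
  "group_has_Liouville_property G T E act \<longleftrightarrow>
     (\<forall>\<mu>. regular_prob_measure T \<mu> \<and> irreducible_measure G T \<mu> \<longrightarrow>
       measure_has_Liouville_property G T \<mu> E act)"

text \<open>A finite-dimensional real vector space is modelled by a type of class
  \<^class>\<open>euclidean_space\<close>; its inner product plays no role. Every linear endomorphism is then a
  bounded linear map, and the operator norm on these induces the usual topology of \<open>GL(V)\<close>.\<close>

definition GL :: "('v::euclidean_space \<Rightarrow>\<^sub>L 'v) monoid" where
  "GL = \<lparr>carrier = {A. bij (blinfun_apply A)}, monoid.mult = (o\<^sub>L), one = id_blinfun\<rparr>"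

definition unipotent :: "('v::euclidean_space \<Rightarrow>\<^sub>L 'v) \<Rightarrow> bool" where
  "unipotent A \<longleftrightarrow> (\<exists>n. \<forall>v. ((\<lambda>w. blinfun_apply A w - w) ^^ n) v = 0)"

definition invariant_vectors :: "('v::euclidean_space \<Rightarrow>\<^sub>L 'v) set \<Rightarrow> 'v set" where
  "invariant_vectors U = {v. \<forall>u \<in> U. blinfun_apply u v = v}"

definition projective_space :: "'v::euclidean_space set set" where
  "projective_space = {L. subspace L \<and> dim L = 1}"

text \<open>The quotient topology from \<open>V - {0}\<close>.\<close>

definition projective_topology :: "'v::euclidean_space set topology" where
  "projective_topology =
     topology (\<lambda>W. W \<subseteq> projective_space \<and> open {v. v \<noteq> 0 \<and> span {v} \<in> W})"

definition projective_action :: "('v::euclidean_space \<Rightarrow>\<^sub>L 'v) \<Rightarrow> 'v set \<Rightarrow> 'v set" where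
  "projective_action A L = blinfun_apply A ` L"

lemma span_in_projective_space: "v \<noteq> 0 \<Longrightarrow> span {v} \<in> projective_space"
  by (simp add: projective_space_def)

lemma projective_space_eq_image: "projective_space = (\<lambda>v. span {v}) ` (- {0})"
proof (intro equalityI subsetI)
  fix L :: "'a set" assume L: "L \<in> projective_space"
  then obtain B where B: "B \<subseteq> L" "independent B" "L \<subseteq> span B" "card B = 1"
    using basis_exists [of L] unfolding projective_space_def by (smt (verit) mem_Collect_eq)
  then obtain v where v: "B = {v}" by (auto simp: card_1_singleton_iff)
  with B have "v \<noteq> 0" using dependent_zero by blast
  moreover have "L = span {v}"
    using B v L by (simp add: projective_space_def span_minimal subset_antisym)
  ultimately show "L \<in> (\<lambda>v. span {v}) ` (- {0})" by auto
qed (auto intro: span_in_projective_space)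

lemma openin_projective_topology:
  "openin projective_topology W \<longleftrightarrow>
     W \<subseteq> projective_space \<and> open {v. v \<noteq> 0 \<and> span {v} \<in> W}"
proof -
  let ?P = "\<lambda>W :: 'a set set. W \<subseteq> projective_space \<and> open {v. v \<noteq> 0 \<and> span {v} \<in> W}"
  have "istopology ?P"
    unfolding istopology_def
  proof (intro conjI allI impI)
    fix S T :: "'a set set" assume *: "?P S" "?P T"
    then show "S \<inter> T \<subseteq> projective_space" by blast
    have "{v. v \<noteq> 0 \<and> span {v} \<in> S \<inter> T} =
        {v. v \<noteq> 0 \<and> span {v} \<in> S} \<inter> {v. v \<noteq> 0 \<and> span {v} \<in> T}" by blast
    with * show "open {v. v \<noteq> 0 \<and> span {v} \<in> S \<inter> T}" by (simp add: open_Int)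
  next
    fix K :: "'a set set set" assume *: "\<forall>S\<in>K. ?P S"
    then show "\<Union>K \<subseteq> projective_space" by blast
    have "{v. v \<noteq> 0 \<and> span {v} \<in> \<Union>K} = (\<Union>S\<in>K. {v. v \<noteq> 0 \<and> span {v} \<in> S})" by blast
    with * show "open {v. v \<noteq> 0 \<and> span {v} \<in> \<Union>K}" by (metis (no_types, lifting) open_UN)
  qed
  then show ?thesis by (simp add: projective_topology_def)
qed

lemma topspace_projective_topology [simp]: "topspace projective_topology = projective_space"
proof -
  have "{v :: 'a. v \<noteq> 0 \<and> span {v} \<in> projective_space} = - {0}"
    using span_in_projective_space by blast
  then have "openin projective_topology (projective_space :: 'a set set)"
    by (simp add: openin_projective_topology open_Compl)
  then show ?thesis
    by (meson openin_projective_topology openin_subset openin_topspace subset_antisym)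
qed

lemma quotient_map_projective_topology:
  "quotient_map (top_of_set (- {0})) projective_topology (\<lambda>v::'v::euclidean_space. span {v})"
proof -
  have o: "open (- {0::'v})" by (simp add: open_Compl)
  have e: "{v \<in> - {0::'v}. span {v} \<in> W} = {v. v \<noteq> 0 \<and> span {v} \<in> W}" for W by blast
  show ?thesis
    unfolding quotient_map_def
    by (auto simp: projective_space_eq_image [symmetric] openin_projective_topology
        openin_open_eq [OF o] e[simplified])
qed

lemma group_GL: "group (GL :: ('v::euclidean_space \<Rightarrow>\<^sub>L 'v) monoid)"
proof (rule groupI)
  fix A :: "'v \<Rightarrow>\<^sub>L 'v" assume "A \<in> carrier GL"
  then have b: "bij (blinfun_apply A)" by (simp add: GL_def)
  have lA: "linear (blinfun_apply A)"
    by (simp add: blinfun.bounded_linear_right bounded_linear.linear)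
  obtain h where h: "linear h" "\<And>x. h (blinfun_apply A x) = x" "\<And>x. blinfun_apply A (h x) = x"
    using linear_injective_isomorphism [OF lA bij_is_inj [OF b]] by blast
  have ap: "blinfun_apply (Blinfun h) = h"
    using h(1) by (simp add: bounded_linear_Blinfun_apply linear_conv_bounded_linear)
  have "Blinfun h o\<^sub>L A = id_blinfun"
    by (intro blinfun_eqI) (simp add: ap h(2))
  moreover have "bij (blinfun_apply (Blinfun h))"
    unfolding ap by (rule o_bij [of "blinfun_apply A"]) (auto simp: fun_eq_iff h(2,3))
  ultimately show "\<exists>B \<in> carrier GL. B \<otimes>\<^bsub>GL\<^esub> A = \<one>\<^bsub>GL\<^esub>"
    by (auto simp: GL_def)
next
  fix A B :: "'v \<Rightarrow>\<^sub>L 'v" assume "A \<in> carrier GL" "B \<in> carrier GL"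
  then have "bij (blinfun_apply A \<circ> blinfun_apply B)" by (simp add: GL_def bij_comp)
  moreover have "blinfun_apply A \<circ> blinfun_apply B = blinfun_apply (A o\<^sub>L B)" by auto
  ultimately show "A \<otimes>\<^bsub>GL\<^esub> B \<in> carrier GL" by (simp add: GL_def)
next
  show "\<one>\<^bsub>GL\<^esub> \<in> carrier (GL :: ('v \<Rightarrow>\<^sub>L 'v) monoid)"
    by (simp add: GL_def bij_def inj_def surj_def)
qed (simp_all add: GL_def blinfun_eqI)

end

theory Submission
  imports Defs
begin

text \<open>The proof rests on the maximum principle. A continuous harmonic function \<open>f\<close> on the compact space
  of lines attains its maximum, and a value equal to the maximum can be an average of values of \<open>f\<close>
  only if \<open>\<mu>\<close>-almost all of these are maximal too. By continuity the set of maximum points is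
  preserved by the support of \<open>\<mu>\<close>, hence, by irreducibility, by all of \<open>G\<close>
  (\<open>harmonic_maximum_set_invariant\<close>). The same applies to \<open>- f\<close>, so the set of minimum points is a
  nonempty closed \<open>G\<close>-invariant set as well.

  It remains to see that any two nonempty closed \<open>U\<close>-invariant sets of lines meet. In fact each of
  them contains the line of vectors fixed by \<open>U\<close>
  (\<open>unipotent_closed_projective_set_contains\<close>), so the maximum of \<open>f\<close> equals its minimum and \<open>f\<close> is
  constant.

  To find a fixed vector on a closed \<open>U\<close>-invariant cone \<open>C\<close>, choose a \<open>U\<close>-invariant subspace \<open>M\<close>
  of maximal dimension that misses \<open>C\<close>. Kolchin's theorem, in the form
  \<open>unipotent_fixes_vector_modulo\<close>, gives a vector \<open>v\<close> outside \<open>M\<close> that \<open>U\<close> fixes modulo \<open>M\<close>. By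
  maximality, \<open>C\<close> meets the affine subspace \<open>v + M\<close>, and since \<open>C\<close> avoids the directions in \<open>M\<close>,
  the intersection is compact. It is \<open>U\<close>-invariant, so it consists of vectors with bounded
  \<open>U\<close>-orbits. But an orbit of a unipotent map is polynomial in time, so a bounded one is a single
  point.

  Kolchin's theorem over the reals is proved with traces instead of matrix algebras over an
  algebraically closed field: all elements of \<open>U\<close> have the same trace, so the linear combinations
  of elements of \<open>U\<close> with coefficient sum zero form an ideal of trace zero. If \<open>U\<close> acted
  irreducibly and nontrivially, this ideal would contain a nonzero idempotent, whose trace is its
  rank and hence positive.\<close>

section \<open>Traces of endomorphisms of a subspace\<close>

definition orthonormal_basis_of :: "'v::euclidean_space set \<Rightarrow> 'v set \<Rightarrow> bool" where
  "orthonormal_basis_of B W \<longleftrightarrow> pairwise orthogonal B \<and> (\<forall>b\<in>B. norm b = 1) \<and> span B = W"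

text \<open>For an orthonormal basis \<open>B\<close> of \<open>W\<close> this is the trace of the endomorphism that \<open>c\<close> induces on
  \<open>W\<close>, provided that \<open>c\<close> maps \<open>W\<close> into itself.\<close>

definition trace_over :: "'v::euclidean_space set \<Rightarrow> ('v \<Rightarrow> 'v) \<Rightarrow> real" where
  "trace_over B c = (\<Sum>b\<in>B. c b \<bullet> b)"

lemma orthonormal_basis_of_exists:
  assumes "subspace (W :: 'v::euclidean_space set)"
  obtains B where "orthonormal_basis_of B W"
  by (metis assms orthonormal_basis_of_def orthonormal_basis_subspace)

lemma orthonormal_basis_of_finite_card:
  assumes "orthonormal_basis_of B (W :: 'v::euclidean_space set)"
  shows "finite B" "card B = dim W"
proof -
  have "0 \<notin> B" using assms unfolding orthonormal_basis_of_def by fastforce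
  then have i: "independent B"
    using assms unfolding orthonormal_basis_of_def by (intro pairwise_orthogonal_independent) auto
  then show "finite B" by (rule independent_imp_finite)
  show "card B = dim W"
    using i assms unfolding orthonormal_basis_of_def by (metis dim_span dim_eq_card_independent)
qed

lemma orthonormal_basis_of_mem:
  assumes "orthonormal_basis_of B (W :: 'v::euclidean_space set)" "b \<in> B"
  shows "b \<in> W"
  using assms unfolding orthonormal_basis_of_def by (auto intro: span_base)

lemma orthonormal_basis_of_expand:
  assumes "orthonormal_basis_of B (W :: 'v::euclidean_space set)" "x \<in> W"
  shows "(\<Sum>b\<in>B. (x \<bullet> b) *\<^sub>R b) = x"
  using assms orthonormal_basis_of_finite_card[OF assms(1)] unfolding orthonormal_basis_of_def
  by (intro orthonormal_basis_expand) auto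

text \<open>Expand \<open>c b\<close> in the basis \<open>B'\<close>, exchange the sums and recognise the expansion of \<open>b'\<close> in \<open>B\<close>.
  The lemma serves both as
  independence of the basis (\<open>W' = W\<close>) and as reduction of a trace to a subspace that contains the
  image, from which the traces of idempotent and nilpotent maps are read off.\<close>

lemma trace_over_image_subspace:
  fixes c :: "'v::euclidean_space \<Rightarrow> 'v"
  assumes B: "orthonormal_basis_of B W" and B': "orthonormal_basis_of B' W'" and sub: "W' \<subseteq> W"
    and c: "linear c" "c ` W \<subseteq> W'"
  shows "trace_over B c = trace_over B' c"
proof -
  have "trace_over B c = (\<Sum>b\<in>B. (\<Sum>b'\<in>B'. (c b \<bullet> b') *\<^sub>R b') \<bullet> b)"
    unfolding trace_over_def
    by (intro sum.cong refl, subst orthonormal_basis_of_expand[OF B'])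
      (use c orthonormal_basis_of_mem[OF B] in auto)
  also have "\<dots> = (\<Sum>b'\<in>B'. \<Sum>b\<in>B. (c b \<bullet> b') * (b' \<bullet> b))"
    by (subst sum.swap) (simp add: inner_sum_left)
  also have "\<dots> = (\<Sum>b'\<in>B'. c (\<Sum>b\<in>B. (b' \<bullet> b) *\<^sub>R b) \<bullet> b')"
    by (simp add: linear_sum[OF c(1)] linear_scale[OF c(1)] inner_sum_left mult.commute)
  also have "\<dots> = trace_over B' c"
    unfolding trace_over_def
    by (intro sum.cong refl, subst orthonormal_basis_of_expand[OF B])
      (use sub orthonormal_basis_of_mem[OF B'] in auto)
  finally show ?thesis .
qed

lemma trace_over_idempotent:
  fixes e :: "'v::euclidean_space \<Rightarrow> 'v"
  assumes B: "orthonormal_basis_of B W" and e: "linear e" "e ` W \<subseteq> W"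
    and idem: "\<And>w. w \<in> W \<Longrightarrow> e (e w) = e w"
  shows "trace_over B e = dim (e ` W)"
proof -
  have "subspace W" using B unfolding orthonormal_basis_of_def by (metis subspace_span)
  then obtain B' where B': "orthonormal_basis_of B' (e ` W)"
    using linear_subspace_image[OF e(1)] orthonormal_basis_of_exists by blast
  have fix_B': "e b \<bullet> b = 1" if "b \<in> B'" for b
  proof -
    have "e b = b" using idem orthonormal_basis_of_mem[OF B' that] by auto
    moreover have "norm b = 1" using B' that unfolding orthonormal_basis_of_def by blast
    ultimately show ?thesis by (simp add: dot_square_norm)
  qed
  have "trace_over B e = trace_over B' e"
    using trace_over_image_subspace[OF B B'] e by blast
  also have "\<dots> = card B'" using fix_B' by (simp add: trace_over_def)
  finally show ?thesis by (simp add: orthonormal_basis_of_finite_card[OF B'])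
qed

text \<open>A nilpotent map shrinks every nonzero invariant subspace strictly, so the trace can be computed on
  smaller and smaller subspaces.\<close>

lemma trace_over_nilpotent:
  fixes c :: "'v::euclidean_space \<Rightarrow> 'v"
  assumes B: "orthonormal_basis_of B W" and c: "linear c" "c ` W \<subseteq> W"
    and nil: "\<And>w. w \<in> W \<Longrightarrow> (c ^^ n) w = 0"
  shows "trace_over B c = 0"
  using assms
proof (induction "dim W" arbitrary: B W rule: less_induct)
  case (less W)
  have W: "subspace W" using less.prems(1) unfolding orthonormal_basis_of_def by (metis subspace_span)
  then have cW: "subspace (c ` W)" using linear_subspace_image[OF c(1)] by blast
  obtain B' where B': "orthonormal_basis_of B' (c ` W)"
    using cW orthonormal_basis_of_exists by blast
  have eq: "trace_over B c = trace_over B' c"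
    using trace_over_image_subspace[OF less.prems(1) B'] less.prems by blast
  show ?case
  proof (cases "c ` W = W")
    case True
    have "(c ^^ k) ` W = W" for k
    proof (induction k)
      case (Suc k)
      have "(c ^^ Suc k) ` W = c ` ((c ^^ k) ` W)" by (simp add: image_image)
      then show ?case using Suc True by simp
    qed simp
    then have "W = (c ^^ n) ` W" by simp
    also have "\<dots> \<subseteq> {0}" using less.prems(4) by auto
    finally have "W \<subseteq> {0}" .
    moreover have "b \<noteq> 0" if "b \<in> B" for b
      using that less.prems(1) unfolding orthonormal_basis_of_def by fastforce
    ultimately have "B = {}" using orthonormal_basis_of_mem[OF less.prems(1)] by blast
    then show ?thesis by (simp add: trace_over_def)
  next
    case False
    then have "dim (c ` W) < dim W"
      by (metis W cW less.prems(3) dim_subset le_neq_implies_less subspace_dim_equal order_refl)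
    then show ?thesis
      using less.hyps[OF _ B' c(1)] less.prems eq by fastforce
  qed
qed

section \<open>Kolchin's theorem for unipotent groups\<close>

lemma dim_image_less:
  fixes g :: "'v::euclidean_space \<Rightarrow> 'w::euclidean_space"
  assumes g: "linear g" and C: "subspace C" and y: "y \<in> C" "y \<noteq> 0" "g y = 0"
  shows "dim (g ` C) < dim C"
proof -
  obtain B where B: "{y} \<subseteq> B" "B \<subseteq> C" "independent B" "C \<subseteq> span B"
    using maximal_independent_subset_extend[of "{y}" C] y by (auto simp: dependent_single)
  have fin: "finite B" and card: "card B = dim C"
    using B independent_imp_finite basis_card_eq_dim by auto
  have "span B = C" using B C by (simp add: span_minimal subset_antisym)
  then have "g ` C = span (g ` B)" using linear_span_image[OF g] by metis
  also have "g ` B = insert 0 (g ` (B - {y}))" using B(1) y(3) by force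
  finally have "g ` C = span (g ` (B - {y}))" by simp
  then have "dim (g ` C) \<le> card (g ` (B - {y}))" using fin dim_le_card'[of "g ` (B - {y})"] by simp
  also have "\<dots> \<le> card (B - {y})" using fin by (simp add: card_image_le)
  also have "\<dots> < card B" using B(1) fin by (meson card_Diff1_less insert_subset)
  finally show ?thesis using card by simp
qed

text \<open>Here \<open>J\<close> is spanned by the differences of elements of \<open>S\<close>; it plays the part of the augmentation
  ideal. If it kills \<open>W\<close>, every element of \<open>S\<close> agrees on \<open>W\<close> with \<open>e\<close>.
  If it does not kill \<open>W\<close>, irreducibility makes \<open>J\<close> move every nonzero vector of \<open>W\<close> to
  every vector of \<open>W\<close>. Take \<open>c\<close> in \<open>J\<close> of minimal positive rank on \<open>W\<close> and \<open>b\<close> in \<open>J\<close> that moves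
  some \<open>c v \<noteq> 0\<close> back to \<open>v\<close>. Then \<open>c b c - c\<close> lies in \<open>J\<close> and has smaller rank, so it vanishes
  on \<open>W\<close>, and \<open>c b\<close> is a nonzero idempotent in \<open>J\<close>. Its trace is its rank, whereas elements of \<open>J\<close>
  have trace zero.\<close>

lemma irreducible_unipotent_trivial:
  fixes S :: "('v::euclidean_space \<Rightarrow>\<^sub>L 'v) set"
  assumes W: "subspace W" and SW: "\<And>s w. s \<in> S \<Longrightarrow> w \<in> W \<Longrightarrow> blinfun_apply s w \<in> W"
    and mult: "\<And>s t. s \<in> S \<Longrightarrow> t \<in> S \<Longrightarrow> s o\<^sub>L t \<in> S"
    and e: "e \<in> S" "\<And>w. w \<in> W \<Longrightarrow> blinfun_apply e w = w"
    and unip: "\<And>s. s \<in> S \<Longrightarrow> \<exists>n. \<forall>w\<in>W. ((\<lambda>x. blinfun_apply s x - x) ^^ n) w = 0"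
    and irred: "\<And>Y. subspace Y \<Longrightarrow> Y \<subseteq> W \<Longrightarrow>
        (\<And>s y. s \<in> S \<Longrightarrow> y \<in> Y \<Longrightarrow> blinfun_apply s y \<in> Y) \<Longrightarrow> Y = {0} \<or> Y = W"
    and s: "s \<in> S" and w: "w \<in> W"
  shows "blinfun_apply s w = w"
proof -
  obtain B where B: "orthonormal_basis_of B W" using W orthonormal_basis_of_exists by blast
  define D where "D = {s - t |s t. s \<in> S \<and> t \<in> S}"
  define J where "J = span D"
  have J: "subspace J" by (simp add: J_def)
  have lin: "linear (blinfun_apply a)" for a :: "'v \<Rightarrow>\<^sub>L 'v"
    by (simp add: blinfun.bounded_linear_right bounded_linear.linear)
  have J_minimal: "J \<subseteq> Y" if "D \<subseteq> Y" "subspace Y" for Y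
    using that unfolding J_def by (rule span_minimal)
  have diff_J: "s - t \<in> J" if "s \<in> S" "t \<in> S" for s t
    using that unfolding J_def D_def by (blast intro: span_base)
  have lin_compose: "linear (\<lambda>a. t o\<^sub>L a)" "linear (\<lambda>a. a o\<^sub>L t)" for t :: "'v \<Rightarrow>\<^sub>L 'v"
    by (simp_all add: bounded_bilinear_blinfun_compose bounded_bilinear.bounded_linear_left
        bounded_bilinear.bounded_linear_right bounded_linear.linear)
  note compose_diff = lin_compose[THEN linear_diff]
  have lin_eval: "linear (\<lambda>a. blinfun_apply a x)" for x :: 'v
    by (simp add: blinfun.bounded_linear_left bounded_linear.linear)
  have JW: "blinfun_apply a w \<in> W" if "a \<in> J" "w \<in> W" for a w
  proof -
    have "J \<subseteq> (\<lambda>a. blinfun_apply a w) -` W"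
      using W SW[OF _ that(2)]
      by (intro J_minimal linear_subspace_vimage lin_eval)
        (auto simp: D_def blinfun.diff_left subspace_diff)
    then show ?thesis using that(1) by blast
  qed
  have SJ: "t o\<^sub>L a \<in> J" if "a \<in> J" "t \<in> S" for a t
  proof -
    have "J \<subseteq> (\<lambda>a. t o\<^sub>L a) -` J"
      using mult[OF that(2)] diff_J by (intro J_minimal linear_subspace_vimage J lin_compose)
        (auto simp: D_def compose_diff)
    then show ?thesis using that(1) by blast
  qed
  have JS: "a o\<^sub>L t \<in> J" if "a \<in> J" "t \<in> S" for a t
  proof -
    have "J \<subseteq> (\<lambda>a. a o\<^sub>L t) -` J"
      using mult[OF _ that(2)] diff_J by (intro J_minimal linear_subspace_vimage J lin_compose)
        (auto simp: D_def compose_diff)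
    then show ?thesis using that(1) by blast
  qed
  have JJ: "a o\<^sub>L b \<in> J" if "a \<in> J" "b \<in> J" for a b
  proof -
    have "J \<subseteq> (\<lambda>b. a o\<^sub>L b) -` J"
      using JS[OF that(1)] J by (intro J_minimal linear_subspace_vimage J lin_compose)
        (auto simp: D_def compose_diff subspace_diff)
    then show ?thesis using that(2) by blast
  qed
  have tr_S: "trace_over B (blinfun_apply t) = card B" if t: "t \<in> S" for t
  proof -
    obtain n where n: "\<And>w. w \<in> W \<Longrightarrow> ((\<lambda>x. blinfun_apply t x - x) ^^ n) w = 0"
      using unip t by blast
    have "linear (\<lambda>x. blinfun_apply t x - x)" using lin by (intro linear_compose_sub linear_id[unfolded id_def])
    then have "trace_over B (\<lambda>x. blinfun_apply t x - x) = 0"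
      using SW[OF t] W by (intro trace_over_nilpotent[OF B _ _ n]) (auto simp: subspace_diff)
    then have "trace_over B (blinfun_apply t) = (\<Sum>b\<in>B. b \<bullet> b)"
      by (simp add: trace_over_def inner_diff_left sum_subtractf)
    also have "\<dots> = (\<Sum>b\<in>B. 1)"
      using B by (intro sum.cong) (auto simp: orthonormal_basis_of_def dot_square_norm)
    finally show ?thesis by simp
  qed
  have tr_J: "trace_over B (blinfun_apply a) = 0" if "a \<in> J" for a
  proof -
    have "J \<subseteq> {a. trace_over B (blinfun_apply a) = 0}"
    proof (rule J_minimal)
      show "D \<subseteq> {a. trace_over B (blinfun_apply a) = 0}"
        using tr_S by (auto simp: D_def trace_over_def blinfun.diff_left inner_diff_left sum_subtractf)
      show "subspace {a. trace_over B (blinfun_apply a) = 0}"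
        unfolding subspace_def
        by (auto simp: trace_over_def blinfun.add_left blinfun.scaleR_left inner_add_left sum.distrib
            simp flip: sum_distrib_left)
    qed
    then show ?thesis using that by blast
  qed
  define Z where "Z = {w \<in> W. \<forall>a\<in>J. blinfun_apply a w = 0}"
  have "Z = {0} \<or> Z = W"
  proof (rule irred)
    show "subspace Z" using W unfolding Z_def subspace_def by (auto simp: blinfun.add_right blinfun.scaleR_right)
    show "blinfun_apply t z \<in> Z" if "t \<in> S" "z \<in> Z" for t z
      using that SW JS[OF _ that(1)] unfolding Z_def by (auto simp flip: blinfun_apply_blinfun_compose)
  qed (auto simp: Z_def)
  moreover have ?thesis if "Z = W"
  proof -
    have "blinfun_apply (s - e) w = 0" using diff_J[OF s e(1)] w that unfolding Z_def by blast
    then show ?thesis using e(2)[OF w] by (simp add: blinfun.diff_left)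
  qed
  moreover have "W = {0}" if Z0: "Z = {0}"
  proof (rule ccontr)
    assume "W \<noteq> {0}"
    then obtain w0 where w0: "w0 \<in> W" "w0 \<noteq> 0" using W subspace_0 by blast
    have trans: "\<exists>b\<in>J. blinfun_apply b x = y" if x: "x \<in> W" "x \<noteq> 0" and y: "y \<in> W" for x y
    proof -
      let ?Y = "(\<lambda>b. blinfun_apply b x) ` J"
      have "?Y = {0} \<or> ?Y = W"
      proof (rule irred)
        show "subspace ?Y"
          by (intro linear_subspace_image J lin_eval)
        show "blinfun_apply t z \<in> ?Y" if "t \<in> S" "z \<in> ?Y" for t z
          using that(2) SJ[OF _ that(1)] by (auto simp flip: blinfun_apply_blinfun_compose)
      qed (use JW x in auto)
      moreover have "?Y \<noteq> {0}" using Z0 x unfolding Z_def by blast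
      ultimately have "y \<in> ?Y" using y by simp
      then show ?thesis by auto
    qed
    define P where "P c \<longleftrightarrow> c \<in> J \<and> (\<exists>v\<in>W. blinfun_apply c v \<noteq> 0)" for c
    have "\<exists>c. P c" using trans[OF w0 w0(1)] w0 unfolding P_def by metis
    then obtain c where c: "P c" and c_min: "\<And>d. P d \<Longrightarrow> dim (blinfun_apply c ` W) \<le> dim (blinfun_apply d ` W)"
      using ex_has_least_nat[of P _ "\<lambda>c. dim (blinfun_apply c ` W)"] by blast
    obtain v where v: "v \<in> W" "blinfun_apply c v \<noteq> 0" and cJ: "c \<in> J" using c unfolding P_def by blast
    obtain b where b: "b \<in> J" "blinfun_apply b (blinfun_apply c v) = v"
      using trans[OF JW[OF cJ v(1)] v(2) v(1)] by blast
    define d where "d = (c o\<^sub>L (b o\<^sub>L c)) - c"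
    have dJ: "d \<in> J" unfolding d_def using JJ b cJ J by (simp add: subspace_diff)
    have "\<not> P d"
    proof
      assume "P d"
      let ?g = "\<lambda>x. blinfun_apply c (blinfun_apply b x) - x"
      let ?C = "blinfun_apply c ` W"
      have g: "linear ?g"
        using linear_compose_sub[OF lin[of "c o\<^sub>L b"] linear_id] by simp
      have C: "subspace ?C" using W lin linear_subspace_image by blast
      \<comment> \<open>On the image of \<open>c\<close>, the map \<open>c b - 1\<close> has the kernel vector \<open>c v\<close>, so \<open>d\<close> has smaller rank than \<open>c\<close>.\<close>
      have dg: "blinfun_apply d ` W = ?g ` ?C"
        by (auto simp: d_def blinfun.diff_left image_image)
      have "dim (?g ` ?C) < dim ?C"
        using dim_image_less[OF g C _ v(2)] v(1) b(2) by auto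
      then show False using c_min[OF \<open>P d\<close>] unfolding dg by linarith
    qed
    then have cbc: "blinfun_apply c (blinfun_apply b (blinfun_apply c x)) = blinfun_apply c x" if "x \<in> W" for x
      using dJ that unfolding P_def d_def by (auto simp: blinfun.diff_left)
    define p where "p = c o\<^sub>L b"
    have pJ: "p \<in> J" unfolding p_def using JJ b cJ by simp
    have "trace_over B (blinfun_apply p) = dim (blinfun_apply p ` W)"
      using JW[OF pJ] cbc JW[OF b(1)] by (intro trace_over_idempotent[OF B lin]) (auto simp: p_def)
    then have "dim (blinfun_apply p ` W) = 0" using tr_J[OF pJ] by simp
    moreover have "blinfun_apply c v \<in> blinfun_apply p ` W"
      using cbc[OF v(1)] JW v cJ by (metis blinfun_apply_blinfun_compose image_eqI p_def)
    ultimately show False using v(2) by (metis dim_eq_0 singletonD subsetD)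
  qed
  moreover have ?thesis if "W = {0}" using w that by (simp add: blinfun.zero_right)
  ultimately show ?thesis by blast
qed

text \<open>Kolchin's theorem for the quotient space by \<open>M\<close>. The quotient is modelled by the orthogonal
  complement of \<open>M\<close>, on which \<open>u\<close> acts as the composition of \<open>u\<close> with the orthogonal projection
  \<open>P\<close>; as \<open>U\<close> preserves the kernel \<open>M\<close> of \<open>P\<close>, these compositions multiply as the elements of \<open>U\<close>
  do and are again unipotent. On a minimal nonzero invariant subspace of the complement they act
  trivially by the irreducible case.\<close>

lemma unipotent_fixes_vector_modulo:
  fixes U :: "('v::euclidean_space \<Rightarrow>\<^sub>L 'v) set"
  assumes one: "id_blinfun \<in> U" and mult: "\<And>u u'. u \<in> U \<Longrightarrow> u' \<in> U \<Longrightarrow> u o\<^sub>L u' \<in> U"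
    and unip: "\<And>u. u \<in> U \<Longrightarrow> unipotent u"
    and M: "subspace M" "M \<noteq> UNIV" and UM: "\<And>u m. u \<in> U \<Longrightarrow> m \<in> M \<Longrightarrow> blinfun_apply u m \<in> M"
  obtains v where "v \<noteq> 0" "\<And>m. m \<in> M \<Longrightarrow> v \<bullet> m = 0" "\<And>u. u \<in> U \<Longrightarrow> blinfun_apply u v - v \<in> M"
proof -
  obtain B where B: "orthonormal_basis_of B M" using M(1) orthonormal_basis_of_exists by blast
  define N where "N = {y. \<forall>m\<in>M. y \<bullet> m = 0}"
  have N: "subspace N" unfolding N_def subspace_def by (auto simp: inner_add_left)
  have MN: "x = 0" if "x \<in> M" "x \<in> N" for x using that unfolding N_def by auto
  define p where "p x = x - (\<Sum>b\<in>B. (x \<bullet> b) *\<^sub>R b)" for x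
  have "linear p" unfolding p_def
    by (intro linearI) (auto simp: inner_add_left scaleR_add_left sum.distrib scaleR_sum_right algebra_simps)
  define P where "P = Blinfun p"
  have P: "blinfun_apply P = p"
    unfolding P_def using \<open>linear p\<close> by (simp add: bounded_linear_Blinfun_apply linear_conv_bounded_linear)
  have P_diff: "x - blinfun_apply P x \<in> M" for x
    using orthonormal_basis_of_mem[OF B] M(1) unfolding P p_def by (auto intro!: subspace_sum subspace_scale)
  have P_N: "blinfun_apply P x \<in> N" for x
    unfolding N_def
  proof clarify
    fix m assume m: "m \<in> M"
    have "x \<bullet> m = x \<bullet> (\<Sum>b\<in>B. (m \<bullet> b) *\<^sub>R b)" using orthonormal_basis_of_expand[OF B m] by simp
    also have "\<dots> = (\<Sum>b\<in>B. (x \<bullet> b) *\<^sub>R b) \<bullet> m"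
      by (simp add: inner_sum_left inner_sum_right inner_commute mult.commute)
    finally show "blinfun_apply P x \<bullet> m = 0" unfolding P p_def by (simp add: inner_diff_left)
  qed
  have P_id: "blinfun_apply P y = y" if "y \<in> N" for y
    using MN[OF P_diff] subspace_diff[OF N that P_N] by fastforce
  have P_0: "blinfun_apply P m = 0" if "m \<in> M" for m
    using MN[OF _ P_N] subspace_diff[OF M(1) that P_diff[of m]] by simp
  have P_u: "blinfun_apply P (blinfun_apply u (blinfun_apply P x)) = blinfun_apply P (blinfun_apply u x)"
    if "u \<in> U" for u x
    using P_0[OF UM[OF that P_diff[of x]]] by (simp add: blinfun.diff_right)
  define S where "S = (\<lambda>u. P o\<^sub>L u) ` U"
  define Q where "Q Y \<longleftrightarrow> subspace Y \<and> Y \<subseteq> N \<and> Y \<noteq> {0} \<and> (\<forall>s\<in>S. \<forall>y\<in>Y. blinfun_apply s y \<in> Y)" for Y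
  have "N \<noteq> {0}"
  proof
    assume "N = {0}"
    then have "blinfun_apply P x = 0" for x using P_N by blast
    then show False using P_diff M(2) by auto
  qed
  then have "Q N" using N P_N unfolding Q_def S_def by auto
  then obtain W where W: "Q W" and W_min: "\<And>Y. Q Y \<Longrightarrow> dim W \<le> dim Y"
    using ex_has_least_nat[of Q N dim] by blast
  have WN: "W \<subseteq> N" and WS: "subspace W" using W unfolding Q_def by auto
  have "blinfun_apply s w = w" if s: "s \<in> S" and w: "w \<in> W" for s w
  proof (rule irreducible_unipotent_trivial[OF WS _ _ _ _ _ _ s w])
    show "blinfun_apply t x \<in> W" if "t \<in> S" "x \<in> W" for t x using W that unfolding Q_def by blast
    show "t o\<^sub>L t' \<in> S" if tt: "t \<in> S" "t' \<in> S" for t t'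
    proof -
      obtain u u' where u: "u \<in> U" "u' \<in> U" "t = P o\<^sub>L u" "t' = P o\<^sub>L u'"
        using tt unfolding S_def by blast
      then have "t o\<^sub>L t' = P o\<^sub>L (u o\<^sub>L u')" by (intro blinfun_eqI) (simp add: P_u)
      then show ?thesis using mult u unfolding S_def by blast
    qed
    show "P o\<^sub>L id_blinfun \<in> S" using one unfolding S_def by blast
    show "blinfun_apply (P o\<^sub>L id_blinfun) x = x" if "x \<in> W" for x using P_id that WN by auto
    show "\<exists>n. \<forall>x\<in>W. ((\<lambda>x. blinfun_apply t x - x) ^^ n) x = 0" if "t \<in> S" for t
    proof -
      obtain u where u: "u \<in> U" "t = P o\<^sub>L u" using \<open>t \<in> S\<close> unfolding S_def by blast
      obtain n where n: "\<And>x. ((\<lambda>x. blinfun_apply u x - x) ^^ n) x = 0"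
        using unip[OF u(1)] unfolding unipotent_def by blast
      have "((\<lambda>x. blinfun_apply t x - x) ^^ k) (blinfun_apply P x) =
          blinfun_apply P (((\<lambda>x. blinfun_apply u x - x) ^^ k) x)" for k x
        by (induction k) (simp_all add: u(2) P_u[OF u(1)] blinfun.diff_right)
      from this[of n] have "((\<lambda>x. blinfun_apply t x - x) ^^ n) (blinfun_apply P x) = 0" for x
        by (simp add: n blinfun.zero_right)
      then have "((\<lambda>x. blinfun_apply t x - x) ^^ n) x = 0" if "x \<in> W" for x
        using P_id[of x] that WN by (metis subsetD)
      then show ?thesis by blast
    qed
    show "Y = {0} \<or> Y = W"
      if "subspace Y" "Y \<subseteq> W" "\<And>s y. s \<in> S \<Longrightarrow> y \<in> Y \<Longrightarrow> blinfun_apply s y \<in> Y" for Y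
      using W_min[of Y] that WN WS subspace_dim_equal[of Y W] unfolding Q_def by blast
  qed
  moreover obtain v where v: "v \<in> W" "v \<noteq> 0" using W subspace_0 unfolding Q_def by blast
  ultimately have "blinfun_apply P (blinfun_apply u v) = v" if "u \<in> U" for u
    using that unfolding S_def by force
  then have "blinfun_apply u v - v \<in> M" if "u \<in> U" for u
    using P_diff[of "blinfun_apply u v"] that by simp
  moreover have "v \<bullet> m = 0" if "m \<in> M" for m using v(1) WN that unfolding N_def by blast
  ultimately show thesis using that v(2) by blast
qed

section \<open>Fixed vectors on closed invariant cones\<close>

text \<open>Put \<open>N = u - 1\<close>. If \<open>u\<close> moved \<open>x\<close>, a suitable power of \<open>N\<close> would take \<open>x\<close> to a vector \<open>y\<close> with
  \<open>N y \<noteq> 0\<close> but \<open>N (N y) = 0\<close>. The orbit of \<open>y\<close> is the arithmetic progression \<open>y + n N y\<close>, which is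
  unbounded, yet it is a linear image of the orbit of \<open>x\<close>.\<close>

lemma unipotent_bounded_orbit_fixed:
  fixes u :: "'v::euclidean_space \<Rightarrow>\<^sub>L 'v"
  assumes u: "unipotent u" and bdd: "bounded (range (\<lambda>n. (blinfun_apply u ^^ n) x))"
  shows "blinfun_apply u x = x"
proof (rule ccontr)
  assume nfix: "blinfun_apply u x \<noteq> x"
  define N where "N w = blinfun_apply u w - w" for w
  have N_eq: "(\<lambda>w. blinfun_apply u w - w) = N" by (simp add: N_def fun_eq_iff)
  define j where "j = (LEAST j. (N ^^ j) x = 0)"
  have "\<exists>j. (N ^^ j) x = 0" using u unfolding unipotent_def N_eq by blast
  then have j0: "(N ^^ j) x = 0" and j_min: "\<And>i. i < j \<Longrightarrow> (N ^^ i) x \<noteq> 0"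
    unfolding j_def by (auto intro: LeastI_ex dest: not_less_Least)
  have "j \<noteq> 0"
  proof
    assume "j = 0"
    then have "x = 0" using j0 by simp
    then show False using nfix by (simp add: blinfun.zero_right)
  qed
  moreover have "j \<noteq> 1" using j0 nfix unfolding N_def by auto
  ultimately obtain k where j: "j = Suc (Suc k)" by (metis One_nat_def not0_implies_Suc)
  define y where "y = (N ^^ k) x"
  have Ny: "N y \<noteq> 0" "N (N y) = 0" using j0 j_min[of "Suc k"] unfolding y_def j by auto
  have orbit_y: "(blinfun_apply u ^^ n) y = y + real n *\<^sub>R N y" for n
  proof (induction n)
    case (Suc n)
    have "blinfun_apply u y = y + N y" "blinfun_apply u (N y) = N y"
      using Ny(2) unfolding N_def by auto
    then show ?case using Suc by (simp add: blinfun.add_right blinfun.scaleR_right scaleR_add_left)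
  qed simp
  have "linear N" unfolding N_def
    by (intro linearI) (auto simp: blinfun.add_right blinfun.scaleR_right algebra_simps)
  then have linear_pow: "linear (N ^^ k)" for k
    by (induction k) (auto intro: linear_compose[unfolded o_def] linear_id simp: o_def)
  have uN: "blinfun_apply u ((N ^^ i) w) = (N ^^ i) (blinfun_apply u w)" for i w
    by (induction i) (simp_all add: N_def blinfun.diff_right)
  have comm: "(N ^^ k) ((blinfun_apply u ^^ n) x) = (blinfun_apply u ^^ n) y" for n
    by (induction n) (simp_all add: y_def flip: uN)
  have "bounded ((N ^^ k) ` range (\<lambda>n. (blinfun_apply u ^^ n) x))"
    using bdd linear_pow by (intro bounded_linear_image) (simp_all add: linear_conv_bounded_linear)
  then obtain K where K: "\<And>n. norm (y + real n *\<^sub>R N y) \<le> K"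
    unfolding bounded_iff by (auto simp: image_image comm orbit_y)
  obtain n where n: "K + norm y < real n * norm (N y)"
    using Ny(1) reals_Archimedean3[of "norm (N y)"] by auto
  have "real n * norm (N y) \<le> norm (y + real n *\<^sub>R N y) + norm y"
    using norm_triangle_ineq4[of "y + real n *\<^sub>R N y" y] by simp
  then show False using K[of n] n by linarith
qed

text \<open>Let \<open>M\<close> be an invariant subspace of maximal dimension among those that miss \<open>C\<close>, and let \<open>v\<close>,
  orthogonal to \<open>M\<close>, be fixed by \<open>U\<close> modulo \<open>M\<close>. The points of \<open>C\<close> on \<open>v + M\<close> form the
  set \<open>A\<close>; every one of its points will do, as soon as \<open>A\<close> is known to be bounded and nonempty. If \<open>A\<close> contained vectors of arbitrarily large norm, their
  directions would accumulate at a unit vector of \<open>M\<close> that lies in \<open>C\<close>.\<close>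

lemma unipotent_invariant_cone_fixed_vector:
  fixes U :: "('v::euclidean_space \<Rightarrow>\<^sub>L 'v) set"
  assumes one: "id_blinfun \<in> U" and mult: "\<And>u u'. u \<in> U \<Longrightarrow> u' \<in> U \<Longrightarrow> u o\<^sub>L u' \<in> U"
    and unip: "\<And>u. u \<in> U \<Longrightarrow> unipotent u"
    and C: "C \<noteq> {}" "0 \<notin> C" "closed (insert 0 C)"
    and scale: "\<And>a x. x \<in> C \<Longrightarrow> a \<noteq> 0 \<Longrightarrow> a *\<^sub>R x \<in> C"
    and UC: "\<And>u x. u \<in> U \<Longrightarrow> x \<in> C \<Longrightarrow> blinfun_apply u x \<in> C"
  obtains x where "x \<in> C" "\<And>u. u \<in> U \<Longrightarrow> blinfun_apply u x = x"
proof -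
  define Q where "Q M \<longleftrightarrow> subspace M \<and> M \<inter> C = {} \<and> (\<forall>u\<in>U. \<forall>m\<in>M. blinfun_apply u m \<in> M)" for M
  have "Q {0}" using C(2) unfolding Q_def by (auto simp: blinfun.zero_right)
  moreover have "\<forall>M. Q M \<longrightarrow> dim M < DIM('v) + 1" by (simp add: less_Suc_eq_le dim_subset_UNIV)
  ultimately obtain M where QM: "Q M" and M_max: "\<And>M'. Q M' \<Longrightarrow> dim M' \<le> dim M"
    using ex_has_greatest_nat[of Q "{0}" dim] by blast
  have M: "subspace M" "M \<inter> C = {}" and UM: "\<And>u m. u \<in> U \<Longrightarrow> m \<in> M \<Longrightarrow> blinfun_apply u m \<in> M"
    using QM unfolding Q_def by auto
  have "M \<noteq> UNIV" using M(2) C(1) by auto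
  then obtain v where v: "v \<noteq> 0" "\<And>m. m \<in> M \<Longrightarrow> v \<bullet> m = 0"
      and uv: "\<And>u. u \<in> U \<Longrightarrow> blinfun_apply u v - v \<in> M"
    using unipotent_fixes_vector_modulo[OF one mult unip M(1) _ UM] by blast
  define M' where "M' = span (insert v M)"
  have M'_iff: "x \<in> M' \<longleftrightarrow> (\<exists>k. x - k *\<^sub>R v \<in> M)" for x
    unfolding M'_def span_breakdown_eq using M(1) by (simp add: span_eq_iff[THEN iffD2])
  have "v \<notin> M" using v(1) v(2)[of v] by auto
  then have "dim M < dim M'"
    unfolding M'_def dim_span using dim_insert[of v M] M(1) by (simp add: span_eq_iff[THEN iffD2])
  then have "\<not> Q M'" using M_max by fastforce
  moreover have "subspace M'" unfolding M'_def by simp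
  moreover have "blinfun_apply u x \<in> M'" if u: "u \<in> U" and "x \<in> M'" for u x
  proof -
    obtain k where "x - k *\<^sub>R v \<in> M" using \<open>x \<in> M'\<close> M'_iff by blast
    then have "blinfun_apply u (x - k *\<^sub>R v) + k *\<^sub>R (blinfun_apply u v - v) \<in> M"
      using u UM uv M(1) by (simp add: subspace_add subspace_scale)
    then have "blinfun_apply u x - k *\<^sub>R v \<in> M"
      by (simp add: blinfun.diff_right blinfun.scaleR_right algebra_simps)
    then show ?thesis using M'_iff by blast
  qed
  ultimately obtain x0 where x0: "x0 \<in> M'" "x0 \<in> C" unfolding Q_def by blast
  then obtain k where k: "x0 - k *\<^sub>R v \<in> M" using M'_iff by blast
  then have "k \<noteq> 0" using x0(2) M(2) by auto
  define x where "x = (1 / k) *\<^sub>R x0"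
  define A where "A = {x \<in> C. x - v \<in> M}"
  have "(1 / k) *\<^sub>R (x0 - k *\<^sub>R v) \<in> M" using k M(1) by (simp add: subspace_scale)
  then have xA: "x \<in> A"
    using x0(2) scale \<open>k \<noteq> 0\<close> unfolding A_def x_def by (simp add: scaleR_diff_right)
  have UA: "blinfun_apply u y \<in> A" if u: "u \<in> U" and "y \<in> A" for u y
  proof -
    have "blinfun_apply u (y - v) + (blinfun_apply u v - v) \<in> M"
      using that UM uv M(1) unfolding A_def by (simp add: subspace_add)
    then show ?thesis using that UC unfolding A_def by (simp add: blinfun.diff_right)
  qed
  have A_M': "y \<in> M'" if "y \<in> A" for y
    using that M'_iff[of y] unfolding A_def by (metis (mono_tags, lifting) mem_Collect_eq scaleR_one)
  have "bounded A"
  proof -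
    \<comment> \<open>The quantity \<open>\<bar>y \<bullet> v\<bar>\<close> has a positive minimum over the unit vectors \<open>y\<close> of the compact set \<open>K\<close>. For \<open>y\<close> in
      \<open>A\<close> the product \<open>y \<bullet> v\<close> is fixed, so normalising \<open>y\<close> bounds its norm.\<close>
    define K where "K = insert 0 C \<inter> M' \<inter> sphere 0 1"
    have "compact K" unfolding K_def
      using C(3) closed_subspace[OF \<open>subspace M'\<close>] by (intro closed_Int_compact closed_Int) auto
    have proj: "(1 / norm y) *\<^sub>R y \<in> K" "y \<noteq> 0" if "y \<in> A" for y
    proof -
      show y0: "y \<noteq> 0" using that C(2) unfolding A_def by blast
      show "(1 / norm y) *\<^sub>R y \<in> K"
        using that y0 scale A_M'[OF that] \<open>subspace M'\<close> unfolding K_def A_def by (simp add: subspace_scale)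
    qed
    then have "K \<noteq> {}" using xA by blast
    moreover have "continuous_on K (\<lambda>y. \<bar>y \<bullet> v\<bar>)" by (intro continuous_intros)
    ultimately obtain y0 where y0: "y0 \<in> K" and y0_min: "\<And>y. y \<in> K \<Longrightarrow> \<bar>y0 \<bullet> v\<bar> \<le> \<bar>y \<bullet> v\<bar>"
      using continuous_attains_inf[OF \<open>compact K\<close>] by blast
    have "y0 \<bullet> v \<noteq> 0"
    proof
      assume y0v: "y0 \<bullet> v = 0"
      obtain k where k: "y0 - k *\<^sub>R v \<in> M" using y0 M'_iff unfolding K_def by blast
      then have "v \<bullet> (y0 - k *\<^sub>R v) = 0" by (rule v(2))
      then have "k = 0" using y0v v(1) by (simp add: inner_diff_right inner_commute)
      then have "y0 \<in> M" using k by simp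
      moreover have "y0 \<in> C" using y0 unfolding K_def by auto
      ultimately show False using M(2) by blast
    qed
    then have e: "\<bar>y0 \<bullet> v\<bar> > 0" by simp
    have "norm y \<le> (v \<bullet> v) / \<bar>y0 \<bullet> v\<bar>" if "y \<in> A" for y
    proof -
      have "v \<bullet> (y - v) = 0" using that v(2) unfolding A_def by blast
      then have "y \<bullet> v = v \<bullet> v" by (simp add: inner_diff_right inner_commute)
      moreover have "\<bar>y0 \<bullet> v\<bar> \<le> \<bar>(1 / norm y) *\<^sub>R y \<bullet> v\<bar>" using y0_min proj(1)[OF that] by blast
      ultimately have "\<bar>y0 \<bullet> v\<bar> \<le> (v \<bullet> v) / norm y" by (simp add: abs_mult)
      then show ?thesis using e proj(2)[OF that] by (simp add: field_simps)
    qed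
    then show ?thesis unfolding bounded_iff by blast
  qed
  have "blinfun_apply u x = x" if u: "u \<in> U" for u
  proof -
    have "(blinfun_apply u ^^ n) x \<in> A" for n by (induction n) (simp_all add: xA UA u)
    then have "bounded (range (\<lambda>n. (blinfun_apply u ^^ n) x))"
      by (intro bounded_subset[OF \<open>bounded A\<close>]) auto
    then show ?thesis by (rule unipotent_bounded_orbit_fixed[OF unip[OF u]])
  qed
  then show thesis using that xA unfolding A_def by blast
qed

section \<open>The maximum principle\<close>

lemma borel_of_sets: "openin T U \<Longrightarrow> U \<in> sets (borel_of T)"
  and borel_of_space: "space (borel_of T) = topspace T"
proof -
  have *: "{U. openin T U} \<subseteq> Pow (topspace T)" using openin_subset by auto
  show "openin T U \<Longrightarrow> U \<in> sets (borel_of T)"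
    unfolding borel_of_def sets_measure_of[OF *] by auto
  show "space (borel_of T) = topspace T"
    unfolding borel_of_def by (rule space_measure_of[OF *])
qed

text \<open>The elements of \<open>G\<close> that map the set \<open>X\<close> of maximum points into itself form a closed
  subsemigroup \<open>H\<close>, so it is enough that \<open>H\<close> contains the support of \<open>\<mu>\<close>. At a maximum point \<open>x\<close> the
  nonnegative function \<open>g \<mapsto> m - f (act g x)\<close> has integral zero, so it vanishes almost everywhere;
  being continuous, it vanishes on the support.\<close>

lemma harmonic_maximum_set_invariant:
  assumes G: "monoid G" and act_in: "\<And>g x. g \<in> carrier G \<Longrightarrow> x \<in> topspace E \<Longrightarrow> act g x \<in> topspace E"
    and act_mult: "\<And>g h x. g \<in> carrier G \<Longrightarrow> h \<in> carrier G \<Longrightarrow> x \<in> topspace E \<Longrightarrow>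
        act (g \<otimes>\<^bsub>G\<^esub> h) x = act g (act h x)"
    and T: "topspace T = carrier G"
    and cont: "\<And>x. x \<in> topspace E \<Longrightarrow> continuous_map T euclideanreal (\<lambda>g. f (act g x))"
    and \<mu>: "regular_prob_measure T \<mu>" "irreducible_measure G T \<mu>"
    and harm: "harmonic_on \<mu> E act f"
    and m: "\<And>y. y \<in> topspace E \<Longrightarrow> f y \<le> m"
    and x: "x \<in> topspace E" "f x = m" and g: "g \<in> carrier G"
  shows "f (act g x) = m"
proof -
  define X where "X = {x \<in> topspace E. f x = m}"
  define H where "H = {g \<in> carrier G. \<forall>x\<in>X. act g x \<in> X}"
  have sets: "sets \<mu> = sets (borel_of T)" and mass: "emeasure \<mu> (space \<mu>) = 1"
    using \<mu>(1) unfolding regular_prob_measure_def by auto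
  have space: "space \<mu> = topspace T" using sets_eq_imp_space_eq[OF sets] by (simp add: borel_of_space)
  interpret finite_measure \<mu> using mass by (intro finite_measureI) simp
  obtain K where K: "\<And>y. y \<in> topspace E \<Longrightarrow> \<bar>f y\<bar> \<le> K"
    using harm unfolding harmonic_on_def bounded_iff by auto
  have "measure_support T \<mu> \<subseteq> H"
  proof
    fix g assume g: "g \<in> measure_support T \<mu>"
    then have gG: "g \<in> carrier G" using T unfolding measure_support_def by blast
    have "act g x \<in> X" if "x \<in> X" for x
    proof (rule ccontr)
      assume nX: "act g x \<notin> X"
      have xE: "x \<in> topspace E" and fx: "f x = m" using that unfolding X_def by auto
      let ?h = "\<lambda>g. f (act g x)"
      have open_pre: "openin T {g \<in> topspace T. ?h g \<in> S}" if "open S" for S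
        using cont[OF xE] that by (simp add: openin_continuous_map_preimage)
      have meas: "?h \<in> borel_measurable \<mu>"
      proof (rule borel_measurableI)
        fix S :: "real set" assume "open S"
        then have "{g \<in> topspace T. ?h g \<in> S} \<in> sets \<mu>" using open_pre sets borel_of_sets by blast
        moreover have "?h -` S \<inter> space \<mu> = {g \<in> topspace T. ?h g \<in> S}" unfolding space by blast
        ultimately show "?h -` S \<inter> space \<mu> \<in> sets \<mu>" by simp
      qed
      have int: "integrable \<mu> ?h"
        using K act_in xE meas by (intro integrable_const_bound[of _ K]) (auto simp: space T)
      have "(\<integral>g. m - ?h g \<partial>\<mu>) = 0"
        using int harm xE fx mass unfolding harmonic_on_def by (simp add: measure_def)
      moreover have "AE g in \<mu>. 0 \<le> m - ?h g" using m act_in xE by (auto simp: space T)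
      ultimately have AE: "AE g in \<mu>. ?h g = m"
        using integral_nonneg_eq_0_iff_AE[of \<mu> "\<lambda>g. m - ?h g"] int by auto
      let ?O = "{g \<in> topspace T. ?h g \<in> - {m}}"
      have O: "openin T ?O" by (rule open_pre) (simp add: open_Compl)
      then have "emeasure \<mu> ?O = 0"
        using AE AE_iff_measurable[of ?O \<mu> "\<lambda>g. ?h g = m"] borel_of_sets[OF O] sets by (simp add: space)
      moreover have "g \<in> ?O" using nX gG act_in xE T unfolding X_def by auto
      then have "emeasure \<mu> ?O > 0" using g O unfolding measure_support_def by blast
      ultimately show False by simp
    qed
    then show "g \<in> H" using gG unfolding H_def by blast
  qed
  moreover have "subsemigroup H G"
    using act_mult monoid.m_closed[OF G] unfolding subsemigroup_def H_def X_def by auto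
  moreover have "closedin T H"
  proof -
    have "closedin T {g \<in> topspace T. f (act g x) \<in> {m}}" if "x \<in> X" for x
      using cont that unfolding X_def by (intro closedin_continuous_map_preimage) auto
    then have "closedin T (topspace T \<inter> (\<Inter>x\<in>X. {g \<in> topspace T. f (act g x) \<in> {m}}))"
      by (cases "X = {}") (auto intro!: closedin_Int closedin_INT)
    moreover have "H = topspace T \<inter> (\<Inter>x\<in>X. {g \<in> topspace T. f (act g x) \<in> {m}})"
      using act_in unfolding H_def X_def T by auto
    ultimately show ?thesis by simp
  qed
  ultimately have "closed_subsemigroup_of_measure G T \<mu> \<subseteq> H"
    unfolding closed_subsemigroup_of_measure_def by blast
  then have "g \<in> H" using g \<mu>(2) unfolding irreducible_measure_def by blast
  then show ?thesis using x unfolding H_def X_def by auto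
qed

section \<open>The Liouville property\<close>

lemma span_singleton_scale:
  assumes "a \<noteq> 0"
  shows "span {a *\<^sub>R v} = span {v :: 'v::real_vector}"
proof -
  have "v = (1 / a) *\<^sub>R (a *\<^sub>R v)" using assms by simp
  then have "v \<in> span {a *\<^sub>R v}" by (metis insertI1 span_base span_scale)
  then show ?thesis by (intro antisym span_minimal) (auto intro: span_base span_scale)
qed

lemma image_span_singleton: "blinfun_apply A ` span {v} = span {blinfun_apply A v}"
  for A :: "'v::euclidean_space \<Rightarrow>\<^sub>L 'v"
  using linear_span_image[of "blinfun_apply A" "{v}"]
  by (simp add: blinfun.bounded_linear_right bounded_linear.linear)

text \<open>A vector fixed by \<open>U\<close> on the cone over \<open>X\<close> spans a line of \<open>X\<close>. There is only one line of fixed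
  vectors.\<close>

lemma unipotent_closed_projective_set_contains:
  fixes U :: "('v::euclidean_space \<Rightarrow>\<^sub>L 'v) set"
  assumes one: "id_blinfun \<in> U" and mult: "\<And>u u'. u \<in> U \<Longrightarrow> u' \<in> U \<Longrightarrow> u o\<^sub>L u' \<in> U"
    and unip: "\<And>u. u \<in> U \<Longrightarrow> unipotent u"
    and dim1: "dim (invariant_vectors U) = 1"
    and X: "closedin projective_topology X" "X \<noteq> {}"
    and UX: "\<And>u L. u \<in> U \<Longrightarrow> L \<in> X \<Longrightarrow> projective_action u L \<in> X"
  shows "invariant_vectors U \<in> X"
proof -
  define C where "C = {v. v \<noteq> 0 \<and> span {v} \<in> X}"
  have XP: "X \<subseteq> projective_space" using closedin_subset[OF X(1)] by simp
  have 0: "span {0::'v} \<notin> X" using XP unfolding projective_space_def by auto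
  obtain x where x: "x \<in> C" and fix_x: "\<And>u. u \<in> U \<Longrightarrow> blinfun_apply u x = x"
  proof (rule unipotent_invariant_cone_fixed_vector[OF one mult unip, of C])
    obtain L where "L \<in> X" using X(2) by blast
    then show "C \<noteq> {}" using XP unfolding C_def projective_space_eq_image by auto
    have "openin projective_topology (projective_space - X)"
      using X(1) by (simp add: closedin_def)
    then have "open {v. v \<noteq> 0 \<and> span {v} \<in> projective_space - X}"
      unfolding openin_projective_topology by blast
    moreover have "- insert 0 C = {v. v \<noteq> 0 \<and> span {v} \<in> projective_space - X}"
      using span_in_projective_space unfolding C_def by blast
    ultimately show "closed (insert 0 C)" by (simp add: closed_def)
    show "a *\<^sub>R v \<in> C" if "v \<in> C" "a \<noteq> 0" for a v
      using that unfolding C_def by (simp add: span_singleton_scale)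
    show "blinfun_apply u v \<in> C" if "u \<in> U" "v \<in> C" for u v
    proof -
      have "span {blinfun_apply u v} \<in> X"
        using UX[OF that(1)] that(2) unfolding C_def projective_action_def image_span_singleton[symmetric] by blast
      then show ?thesis using 0 unfolding C_def by auto
    qed
  qed (auto simp: C_def)
  have inv: "subspace (invariant_vectors U)"
    unfolding invariant_vectors_def subspace_def
    by (auto simp: blinfun.add_right blinfun.scaleR_right blinfun.zero_right)
  have "span {x} \<subseteq> invariant_vectors U"
    using fix_x by (intro span_minimal inv) (simp add: invariant_vectors_def)
  moreover have "dim (span {x}) = 1" using x span_in_projective_space unfolding C_def projective_space_def by blast
  ultimately have "span {x} = invariant_vectors U"
    using subspace_dim_equal[of "span {x}"] inv dim1 by simp
  moreover have "span {x} \<in> X" using x unfolding C_def by blast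
  ultimately show ?thesis by simp
qed

theorem theorem1p3:
  fixes G U :: "('v::euclidean_space \<Rightarrow>\<^sub>L 'v) set"
  assumes "subgroup G GL"
    and "locally_compact_space (top_of_set G)"
    and "subgroup U (GL\<lparr>carrier := G\<rparr>)"
    and "\<forall>u \<in> U. unipotent u"
    and "dim (invariant_vectors U) = 1"
  shows "group_has_Liouville_property (GL\<lparr>carrier := G\<rparr>) (top_of_set G)
           projective_topology projective_action"
  unfolding group_has_Liouville_property_def measure_has_Liouville_property_def
proof (intro allI impI ballI, elim conjE)
  fix \<mu> and f :: "'v set \<Rightarrow> real" and g and L :: "'v set"
  assume \<mu>: "regular_prob_measure (top_of_set G) \<mu>"
      "irreducible_measure (GL\<lparr>carrier := G\<rparr>) (top_of_set G) \<mu>"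
    and g: "g \<in> closed_subgroup_of_measure (GL\<lparr>carrier := G\<rparr>) (top_of_set G) \<mu>"
    and L: "L \<in> topspace projective_topology"
    and f: "continuous_map projective_topology euclideanreal f"
    and harm: "harmonic_on \<mu> projective_topology projective_action f"
  interpret G: group "GL\<lparr>carrier := G\<rparr>"
    using assms(1) group_GL by (rule subgroup.subgroup_is_group)
  have inj: "blinfun_apply a v \<noteq> 0" if "a \<in> G" "v \<noteq> 0" for a v
  proof -
    have "inj (blinfun_apply a)"
      using subgroup.subset[OF assms(1)] that(1) by (auto simp: GL_def bij_is_inj)
    then show ?thesis using that(2) by (metis blinfun.zero_right injD)
  qed
  have UG: "U \<subseteq> G" using subgroup.subset[OF assms(3)] by simp
  have one: "id_blinfun \<in> U" using subgroup.one_closed[OF assms(3)] by (simp add: GL_def)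
  have mult: "u o\<^sub>L u' \<in> U" if "u \<in> U" "u' \<in> U" for u u'
    using subgroup.m_closed[OF assms(3) that] by (simp add: GL_def)
  have act_in: "projective_action a K \<in> projective_space" if a: "a \<in> G" and K: "K \<in> projective_space" for a K
  proof -
    obtain v where v: "v \<noteq> 0" "K = span {v}" using K unfolding projective_space_eq_image by auto
    then show ?thesis
      unfolding projective_action_def v(2) image_span_singleton
      by (intro span_in_projective_space inj a)
  qed
  have line_cont: "continuous_on (- {0}) (\<lambda>v. h (span {v}))"
    if "continuous_map projective_topology euclideanreal h" for h :: "'v set \<Rightarrow> real"
    using continuous_map_compose[OF quotient_imp_continuous_map[OF quotient_map_projective_topology] that]
    by (simp add: o_def)
  \<comment> \<open>Compactness of the projective space enters through that of the unit sphere.\<close>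
  have attains: "\<exists>K\<in>projective_space. \<forall>K'\<in>projective_space. h K' \<le> h K"
    if h: "continuous_map projective_topology euclideanreal h" for h :: "'v set \<Rightarrow> real"
  proof -
    obtain v0 :: 'v where "norm v0 = 1" using vector_choose_size[of 1] by auto
    then have "sphere (0::'v) 1 \<noteq> {}" by auto
    moreover have "continuous_on (sphere 0 1) (\<lambda>v. h (span {v}))"
      by (rule continuous_on_subset[OF line_cont[OF h]]) auto
    ultimately obtain v where "v \<in> sphere 0 1" "\<forall>w\<in>sphere 0 1. h (span {w}) \<le> h (span {v})"
      using continuous_attains_sup[of "sphere (0::'v) 1" "\<lambda>v. h (span {v})"] compact_sphere by blast
    then have v: "norm v = 1" "\<And>w. norm w = 1 \<Longrightarrow> h (span {w}) \<le> h (span {v})" by auto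
    have "h K' \<le> h (span {v})" if K': "K' \<in> projective_space" for K'
    proof -
      obtain w where w: "w \<noteq> 0" "K' = span {w}" using K' unfolding projective_space_eq_image by auto
      then have "K' = span {(1 / norm w) *\<^sub>R w}" by (simp add: span_singleton_scale)
      then show ?thesis using v(2)[of "(1 / norm w) *\<^sub>R w"] w(1) by simp
    qed
    moreover have "v \<noteq> 0" using v(1) by auto
    ultimately show ?thesis using span_in_projective_space by blast
  qed
  have max_line: "h K \<le> h (invariant_vectors U)"
    if h: "continuous_map projective_topology euclideanreal h"
      and hh: "harmonic_on \<mu> projective_topology projective_action h"
      and K: "K \<in> projective_space" for h :: "'v set \<Rightarrow> real" and K
  proof -
    obtain K0 where K0: "K0 \<in> projective_space" "\<And>K. K \<in> projective_space \<Longrightarrow> h K \<le> h K0"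
      using attains[OF h] by blast
    define X where "X = {K \<in> projective_space. h K = h K0}"
    have "continuous_map (top_of_set G) euclideanreal (\<lambda>a. h (projective_action a K))"
      if K: "K \<in> projective_space" for K
    proof -
      obtain v where v: "v \<noteq> 0" "K = span {v}" using K unfolding projective_space_eq_image by auto
      have "continuous_on G (\<lambda>a. h (span {blinfun_apply a v}))"
        by (rule continuous_on_compose2[OF line_cont[OF h]])
          (use inj v(1) in \<open>auto intro!: continuous_intros\<close>)
      then show ?thesis by (simp add: v(2) projective_action_def image_span_singleton)
    qed
    then have inv: "h (projective_action a K) = h K0" if "K \<in> X" "a \<in> G" for a K
      using that act_in K0(2) unfolding X_def
      by (intro harmonic_maximum_set_invariant[OF G.is_monoid _ _ _ _ \<mu> hh])
        (auto simp: projective_action_def GL_def image_image)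
    have "closedin projective_topology {K \<in> topspace projective_topology. h K \<in> {h K0}}"
      by (rule closedin_continuous_map_preimage[OF h]) simp
    then have "invariant_vectors U \<in> X"
      using assms(4,5) K0(1) inv act_in UG unfolding X_def
      by (intro unipotent_closed_projective_set_contains[OF one mult]) auto
    then show ?thesis using K0(2)[OF K] unfolding X_def by simp
  qed
  \<comment> \<open>The fixed line is a maximum point of \<open>f\<close> and of \<open>- f\<close>.\<close>
  have "harmonic_on \<mu> projective_topology projective_action (\<lambda>K. - f K)"
    using harm unfolding harmonic_on_def
    by (auto simp: bounded_iff)
  then have const: "f K = f (invariant_vectors U)" if "K \<in> projective_space" for K
    using max_line[OF f harm that] max_line[of "\<lambda>K. - f K" K] f that by (force intro: continuous_map_minus)
  have "measure_support (top_of_set G) \<mu> \<subseteq> G" unfolding measure_support_def by auto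
  then have "g \<in> G"
    using g G.subgroup_self unfolding closed_subgroup_of_measure_def by force
  then show "f (projective_action g L) = f L" using const act_in L by simp
qed

end
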